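(* Let $\mathcal{P}$ be a graph property. Suppose that for every $\varepsilon>0$ there exists a family $\mathcal{F}(\varepsilon)$ of graph properties which is an $\varepsilon$-cover for $\mathcal{P}$, and such that for each $\mathcal{P}'\in\mathcal{F}(\varepsilon)$ there is an algorithm $\mathcal{A}_{\mathcal{P}',\varepsilon}$ that, given $\delta>0$, queries the induced subgraph of the input graph $G$ on at most $q_\varepsilon\cdot\log(1/\delta)$ vertices selected uniformly at random, and outputs a value $\hat\Delta_{\mathcal{P}'}$ with $|\hat\Delta_{\mathcal{P}'}-\Delta(G,\mathcal{P}')|\le\varepsilon/2$ with probability at least $1-\delta$. Then there exists a distance-approximation algorithm for $\mathcal{P}$ whose query complexity is $O(\log^2(|\mathcal{F}(\varepsilon)|)\cdot q_\varepsilon^2)$.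
   Context: Graphs are finite, simple, undirected with $n$ vertices. $\Delta(G,G')=(|E\setminus E'|+|E'\setminus E|)/n^2$ for $G=(V,E)$, $G'=(V,E')$, and $\Delta(G,\mathcal{Q})=\min_{G'\in\mathcal{Q}}\Delta(G,G')$ for a property (set of graphs) $\mathcal{Q}$. A family $\mathcal{F}$ of graph properties is an $\varepsilon$-cover for $\mathcal{P}$ if (1) for each $G\in\mathcal{P}$ there is $\mathcal{P}'\in\mathcal{F}$ with $\Delta(G,\mathcal{P}')\le\varepsilon/2$, and (2) for each $G'\in\bigcup_{\mathcal{P}'\in\mathcal{F}}\mathcal{P}'$, $\Delta(G',\mathcal{P})\le\varepsilon/2$. A distance-approximation algorithm for $\mathcal{P}$ is a randomized algorithm that, for every graph $G$ and every $\varepsilon\in(0,1)$, given $\varepsilon$ and adjacency-matrix query access to $G$, outputs $\hat\Delta$ with $|\hat\Delta-\Delta(G,\mathcal{P})|\le\varepsilon$ with probability at least $2/3$; its query complexity is the number of adjacency queries.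
   Formalization: In the query bound, log|F(ε)| is read as max(1, log₂|F(ε)|), since for a one-member family the literal bound would be zero queries, which is false (e.g. for the property of having no edges). *)

theory Defs
  imports "HOL-Probability.Probability"
begin

text \<open>
  A graph is a pair \<open>(n, E)\<close> with vertex set \<open>{..<n}\<close>. A graph property is any set of such
  graphs, possibly of various orders; closure under isomorphism is not required.
\<close>

type_synonym graph = "nat \<times> nat set set"

definition graphs :: "graph set" where
  "graphs = {(n, E). E \<subseteq> {{u, v} | u v. u < n \<and> v < n \<and> u \<noteq> v}}"

text \<open>Only used for two graphs of the same order.\<close>

definition graph_dist :: "graph \<Rightarrow> graph \<Rightarrow> real" where
  "graph_dist G G' =
     real (card (snd G - snd G') + card (snd G' - snd G)) / (real (fst G))\<^sup>2"

text \<open>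
  There are finitely many graphs of a given order, so the infimum is a minimum, except that it
  is \<open>\<infinity>\<close> when the property contains no graph of the order of \<open>G\<close>.
\<close>

definition property_dist :: "graph \<Rightarrow> graph set \<Rightarrow> ereal" where
  "property_dist G Q = (INF G' \<in> {G' \<in> Q. fst G' = fst G}. ereal (graph_dist G G'))"

definition is_cover :: "real \<Rightarrow> graph set set \<Rightarrow> graph set \<Rightarrow> bool" where
  "is_cover \<epsilon> F P \<longleftrightarrow>
     (\<forall>G \<in> P. \<exists>P' \<in> F. property_dist G P' \<le> ereal (\<epsilon> / 2)) \<and>
     (\<forall>G' \<in> \<Union>F. property_dist G' P \<le> ereal (\<epsilon> / 2))"

text \<open>
  \<open>out G\<close> is the output distribution of a randomized algorithm on input \<open>G\<close>. Nothing is asked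
  of it on graphs whose distance to \<open>Q\<close> is a minimum over the empty set.
\<close>

definition approximates ::
  "(graph \<Rightarrow> real pmf) \<Rightarrow> graph set \<Rightarrow> real \<Rightarrow> real \<Rightarrow> bool" where
  "approximates out Q err p \<longleftrightarrow>
     (\<forall>G \<in> graphs. property_dist G Q \<noteq> \<infinity> \<longrightarrow>
        measure_pmf.prob (out G) {r. \<bar>ereal r - property_dist G Q\<bar> \<le> ereal err} \<ge> p)"

text \<open>
  A sample-based algorithm draws a uniformly random set \<open>S\<close> of \<open>m n \<delta>\<close> distinct vertices and
  computes its output from \<open>S\<close>, the subgraph induced by \<open>S\<close> and internal coins. Sampling with
  replacement, or a random number of vertices below a bound, is covered: the coins of \<open>D\<close> can
  discard part of \<open>S\<close>.
\<close>

definition sample_output ::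
  "(nat \<Rightarrow> real \<Rightarrow> nat) \<Rightarrow> (nat \<Rightarrow> real \<Rightarrow> nat set \<Rightarrow> nat set set \<Rightarrow> real pmf) \<Rightarrow>
   real \<Rightarrow> graph \<Rightarrow> real pmf" where
  "sample_output m D \<delta> G =
     bind_pmf (pmf_of_set {S. S \<subseteq> {..<fst G} \<and> card S = m (fst G) \<delta>})
       (\<lambda>S. D (fst G) \<delta> S {e \<in> snd G. e \<subseteq> S})"

definition sample_estimator ::
  "(nat \<Rightarrow> real \<Rightarrow> nat) \<Rightarrow> (nat \<Rightarrow> real \<Rightarrow> nat set \<Rightarrow> nat set set \<Rightarrow> real pmf) \<Rightarrow>
   real \<Rightarrow> graph set \<Rightarrow> real \<Rightarrow> bool" where
  "sample_estimator m D q Q err \<longleftrightarrow>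
     (\<forall>\<delta>. 0 < \<delta> \<and> \<delta> < 1 \<longrightarrow>
        (\<forall>n. m n \<delta> \<le> n \<and> real (m n \<delta>) \<le> q * log 2 (1 / \<delta>)) \<and>
        approximates (sample_output m D \<delta>) Q err (1 - \<delta>))"

text \<open>
  A deterministic algorithm with adjacency-matrix access is a decision tree: \<open>Query u v t0 t1\<close>
  continues with \<open>t1\<close> if \<open>u\<close> and \<open>v\<close> are adjacent and with \<open>t0\<close> otherwise. A randomized one is
  a distribution over decision trees, chosen depending on its inputs \<open>n\<close> and \<open>\<epsilon>\<close>.
\<close>

datatype decision_tree = Output real | Query nat nat decision_tree decision_tree

primrec tree_output :: "nat set set \<Rightarrow> decision_tree \<Rightarrow> real" where
  "tree_output E (Output r) = r"
| "tree_output E (Query u v t0 t1) =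
     (if {u, v} \<in> E then tree_output E t1 else tree_output E t0)"

primrec tree_queries :: "nat set set \<Rightarrow> decision_tree \<Rightarrow> nat" where
  "tree_queries E (Output r) = 0"
| "tree_queries E (Query u v t0 t1) =
     Suc (if {u, v} \<in> E then tree_queries E t1 else tree_queries E t0)"

definition distance_approximation_algorithm ::
  "(nat \<Rightarrow> real \<Rightarrow> decision_tree pmf) \<Rightarrow> graph set \<Rightarrow> bool" where
  "distance_approximation_algorithm A P \<longleftrightarrow>
     (\<forall>\<epsilon>. 0 < \<epsilon> \<and> \<epsilon> < 1 \<longrightarrow>
        approximates (\<lambda>G. map_pmf (tree_output (snd G)) (A (fst G) \<epsilon>)) P \<epsilon> (2 / 3))"

text \<open>Worst case over all input graphs and all outcomes of the coins.\<close>

definition query_complexity_le ::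
  "(nat \<Rightarrow> real \<Rightarrow> decision_tree pmf) \<Rightarrow> (real \<Rightarrow> real) \<Rightarrow> bool" where
  "query_complexity_le A b \<longleftrightarrow>
     (\<forall>\<epsilon>. 0 < \<epsilon> \<and> \<epsilon> < 1 \<longrightarrow>
        (\<forall>G \<in> graphs. \<forall>t \<in> set_pmf (A (fst G) \<epsilon>). real (tree_queries (snd G) t) \<le> b \<epsilon>))"

text \<open>
  The logarithm in the query bound, with the usual convention that it is at least \<open>1\<close>: a
  one-member family does not make queries unnecessary.
\<close>

definition log_bound :: "nat \<Rightarrow> real" where
  "log_bound k = max 1 (log 2 (real k))"

end

theory Submission
  imports Defs
begin

text \<open>
  All members of the cover that contain a graph of the right order share one uniformly random
  vertex set, of the largest size that any of the estimators asks for at confidence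
  \<open>\<delta> = 1 / (3 |F|)\<close>. A uniformly random subset of it is a uniformly random subset of all
  vertices, so each estimator sees a sample of the right distribution, and by the union bound all
  estimates are correct up to \<open>\<epsilon> / 2\<close> with probability \<open>2 / 3\<close>. Independence plays no role. The
  cover property makes the least distance to a member of the cover an \<open>\<epsilon> / 2\<close>-approximation of the
  distance to \<open>P\<close>, so the least estimate is correct up to \<open>\<epsilon>\<close>.
\<close>

section \<open>Distances\<close>

lemma finite_graphs_of_order: "finite {G \<in> graphs. fst G = n}"
proof -
  have "{{u, v} | u v. u < n \<and> v < n \<and> u \<noteq> v} \<subseteq> Pow {..<n}"
    by auto
  then have "finite (Pow {{u, v} | u v. u < n \<and> v < n \<and> u \<noteq> v})"
    by (meson finite_Pow_iff finite_lessThan finite_subset)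
  moreover have "{G \<in> graphs. fst G = n} \<subseteq> {n} \<times> Pow {{u, v} | u v. u < n \<and> v < n \<and> u \<noteq> v}"
    by (auto simp: graphs_def)
  ultimately show ?thesis
    by (meson finite.emptyI finite.insertI finite_SigmaI finite_subset)
qed

lemma finite_edges:
  assumes "G \<in> graphs"
  shows "finite (snd G)"
proof -
  have "snd G \<subseteq> Pow {..<fst G}"
    using assms by (auto simp: graphs_def)
  then show ?thesis
    by (meson finite_Pow_iff finite_lessThan finite_subset)
qed

text \<open>The inclusion of \<open>A - C\<close> in the union of \<open>A - B\<close> and
  \<open>B - C\<close> bounds each half of the symmetric difference. \<open>graph_dist\<close>
  normalises by the order of its first argument, so \<open>fst G = fst H\<close> gives all three
  terms the same denominator.\<close>

lemma graph_dist_triangle: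
  assumes "G \<in> graphs" "H \<in> graphs" "K \<in> graphs" "fst G = fst H"
  shows "graph_dist G K \<le> graph_dist G H + graph_dist H K"
proof -
  have fin: "finite (snd G)" "finite (snd H)" "finite (snd K)"
    using assms finite_edges by auto
  have diff: "card (A - C) \<le> card (A - B) + card (B - C)"
    if "finite A" "finite B" for A B C :: "nat set set"
  proof -
    have "card (A - C) \<le> card ((A - B) \<union> (B - C))"
      using that by (intro card_mono) auto
    then show ?thesis
      using card_Un_le[of "A - B" "B - C"] by linarith
  qed
  have "card (snd G - snd K) + card (snd K - snd G)
      \<le> (card (snd G - snd H) + card (snd H - snd G))
        + (card (snd H - snd K) + card (snd K - snd H))"
    using diff[of "snd G" "snd H" "snd K"] diff[of "snd K" "snd H" "snd G"] fin by linarith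
  then have "real (card (snd G - snd K) + card (snd K - snd G))
      \<le> real (card (snd G - snd H) + card (snd H - snd G))
        + real (card (snd H - snd K) + card (snd K - snd H))"
    by linarith
  then show ?thesis
    unfolding graph_dist_def assms(4) add_divide_distrib[symmetric]
    by (rule divide_right_mono) simp
qed

lemma property_dist_le:
  "G' \<in> Q \<Longrightarrow> fst G' = fst G \<Longrightarrow> property_dist G Q \<le> ereal (graph_dist G G')"
  unfolding property_dist_def by (rule INF_lower) auto

text \<open>Distances between graphs are real, so only an infimum over the empty set is infinite.
  Hence finiteness depends on \<open>G\<close> through its order alone, which an algorithm knows
  without making queries.\<close>

lemma property_dist_infinity_iff:
  "property_dist G Q = \<infinity> \<longleftrightarrow> (\<forall>G'\<in>Q. fst G' \<noteq> fst G)"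
proof
  show "\<forall>G'\<in>Q. fst G' \<noteq> fst G" if "property_dist G Q = \<infinity>"
    using that property_dist_le[of _ Q G] by fastforce
next
  assume "\<forall>G'\<in>Q. fst G' \<noteq> fst G"
  then have "{G' \<in> Q. fst G' = fst G} = {}"
    by auto
  then show "property_dist G Q = \<infinity>"
    unfolding property_dist_def by (simp only: image_empty Inf_empty top_ereal_def)
qed

text \<open>Replaces a finite extended-real distance by the real distance to a concrete closest
  graph, to which the triangle inequality applies.\<close>

lemma property_dist_attained:
  assumes "Q \<subseteq> graphs" "property_dist G Q \<noteq> \<infinity>"
  obtains G' where "G' \<in> Q" "fst G' = fst G" "property_dist G Q = ereal (graph_dist G G')"
proof -
  let ?D = "(\<lambda>G'. ereal (graph_dist G G')) ` {G' \<in> Q. fst G' = fst G}"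
  have "finite {G' \<in> Q. fst G' = fst G}"
    using assms(1) by (auto intro: finite_subset[OF _ finite_graphs_of_order[of "fst G"]])
  then have "finite ?D"
    by simp
  moreover have "?D \<noteq> {}"
    using assms(2) property_dist_infinity_iff by auto
  ultimately have "Min ?D \<in> ?D" "Min ?D = Inf ?D"
    by (rule Min_in, rule Min_Inf)
  then have "Inf ?D \<in> ?D"
    by simp
  then obtain G' where "G' \<in> Q" "fst G' = fst G" "Inf ?D = ereal (graph_dist G G')"
    by (elim imageE) auto
  then show ?thesis
    by (intro that[of G']) (auto simp only: property_dist_def)
qed

text \<open>Each of the two inequalities follows one half of the cover property along a triangle
  inequality and loses \<open>\<epsilon> / 2\<close> there and another \<open>\<epsilon> / 2\<close>
  to the estimate. The minimum ranges over the members at finite distance, as \<open>r\<close> is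
  controlled only on these.\<close>

lemma cover_approximation:
  assumes F: "finite F" "\<forall>P'\<in>F. P' \<subseteq> graphs" and P: "P \<subseteq> graphs"
    and cover: "is_cover \<epsilon> F P" and G: "G \<in> graphs" and fin: "property_dist G P \<noteq> \<infinity>"
    and est: "\<And>P'. P' \<in> F \<Longrightarrow> property_dist G P' \<noteq> \<infinity> \<Longrightarrow>
      \<bar>ereal (r P') - property_dist G P'\<bar> \<le> ereal (\<epsilon> / 2)"
  shows "\<bar>ereal (Min (r ` {P' \<in> F. property_dist G P' \<noteq> \<infinity>})) - property_dist G P\<bar> \<le> ereal \<epsilon>"
proof -
  let ?R = "r ` {P' \<in> F. property_dist G P' \<noteq> \<infinity>}"
  obtain H where H: "H \<in> P" "fst H = fst G" "property_dist G P = ereal (graph_dist G H)"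
    using property_dist_attained[OF P fin] .
  \<comment> \<open>Upper bound: from \<open>G\<close> to its closest graph \<open>H\<close> in
    \<open>P\<close>, and on to a graph \<open>H1\<close> of the member \<open>P1\<close> that
    covers \<open>H\<close>.\<close>
  obtain P1 where P1: "P1 \<in> F" "property_dist H P1 \<le> ereal (\<epsilon> / 2)"
    using cover H(1) unfolding is_cover_def by blast
  then have "property_dist H P1 \<noteq> \<infinity>"
    by auto
  then obtain H1 where H1: "H1 \<in> P1" "fst H1 = fst H"
      "property_dist H P1 = ereal (graph_dist H H1)"
    using property_dist_attained F(2) P1(1) by metis
  \<comment> \<open>\<open>H1\<close> has the order of \<open>G\<close>, so the estimate for
    \<open>P1\<close> takes part in the minimum.\<close>
  have P1_fin: "property_dist G P1 \<noteq> \<infinity>"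
    using H1 H property_dist_infinity_iff by metis
  have "graph_dist G H1 \<le> graph_dist G H + graph_dist H H1"
    using graph_dist_triangle G H H1 P F(2) P1(1) by (metis subsetD)
  also have "\<dots> \<le> graph_dist G H + \<epsilon> / 2"
    using P1(2) H1(3) by simp
  finally have "property_dist G P1 \<le> ereal (graph_dist G H + \<epsilon> / 2)"
    using property_dist_le[of H1 P1 G] H1 H by (metis ereal_less_eq(3) order_trans)
  moreover have "\<bar>ereal (r P1) - property_dist G P1\<bar> \<le> ereal (\<epsilon> / 2)"
    using est P1(1) P1_fin .
  moreover obtain d where "property_dist G P1 = ereal d"
    using property_dist_attained[OF _ P1_fin] F(2) P1(1) by metis
  ultimately have "d \<le> graph_dist G H + \<epsilon> / 2" "\<bar>r P1 - d\<bar> \<le> \<epsilon> / 2"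
    by simp_all
  then have r1: "r P1 \<le> graph_dist G H + \<epsilon>"
    by linarith
  have "P1 \<in> {P' \<in> F. property_dist G P' \<noteq> \<infinity>}"
    using P1(1) P1_fin by simp
  then have R: "finite ?R" "r P1 \<in> ?R"
    using F(1) by auto
  have upper: "Min ?R \<le> graph_dist G H + \<epsilon>"
    using Min_le[OF R] r1 by linarith
  \<comment> \<open>Lower bound: from \<open>G\<close> to the closest graph \<open>H2\<close> of the
    member \<open>P2\<close> attaining the minimum, and on to a graph \<open>H3\<close> of
    \<open>P\<close>, which is no closer to \<open>G\<close> than \<open>H\<close> is.\<close>
  obtain P2 where P2: "P2 \<in> F" "property_dist G P2 \<noteq> \<infinity>" "Min ?R = r P2"
    using Min_in[OF R(1)] R(2) by auto
  obtain H2 where H2: "H2 \<in> P2" "fst H2 = fst G" "property_dist G P2 = ereal (graph_dist G H2)"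
    using property_dist_attained F(2) P2 by metis
  have d2: "property_dist H2 P \<le> ereal (\<epsilon> / 2)"
    using cover P2(1) H2(1) unfolding is_cover_def by blast
  then have "property_dist H2 P \<noteq> \<infinity>"
    by auto
  then obtain H3 where H3: "H3 \<in> P" "fst H3 = fst H2"
      "property_dist H2 P = ereal (graph_dist H2 H3)"
    using property_dist_attained[OF P] by metis
  have "graph_dist G H \<le> graph_dist G H3"
    using property_dist_le[of H3 P G] H3 H2 H by simp
  also have "\<dots> \<le> graph_dist G H2 + graph_dist H2 H3"
    using graph_dist_triangle G H2 H3 P F(2) P2(1) by (metis subsetD)
  also have "\<dots> \<le> graph_dist G H2 + \<epsilon> / 2"
    using d2 H3(3) by simp
  finally have "graph_dist G H \<le> graph_dist G H2 + \<epsilon> / 2" .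
  moreover have "\<bar>r P2 - graph_dist G H2\<bar> \<le> \<epsilon> / 2"
    using est[OF P2(1,2)] H2(3) by simp
  ultimately have "\<bar>Min ?R - graph_dist G H\<bar> \<le> \<epsilon>"
    using upper P2(3) by linarith
  then show ?thesis
    using H(3) by simp
qed

section \<open>Sampling\<close>

text \<open>A fixed \<open>m\<close>-set lies in equally many \<open>M\<close>-sets as any other
  \<open>m\<close>-set, and each of these selects it with the same probability
  \<open>1 / (M choose m)\<close>. Comparing the constants is an identity of binomial
  coefficients.\<close>

lemma subset_of_random_subset:
  assumes V: "finite V" and m: "m \<le> M" "M \<le> card V"
  shows "bind_pmf (pmf_of_set {S. S \<subseteq> V \<and> card S = M})
      (\<lambda>S. pmf_of_set {T. T \<subseteq> S \<and> card T = m}) = pmf_of_set {T. T \<subseteq> V \<and> card T = m}"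
proof (rule pmf_eqI)
  fix T
  define n where "n = card V"
  let ?U = "\<lambda>k. {S. S \<subseteq> V \<and> card S = k}"
  have fin: "finite (?U k)" for k
    using V by simp
  have cardU: "card (?U k) = n choose k" for k
    using n_subsets[OF V] n_def by simp
  have ne: "?U k \<noteq> {}" if "k \<le> n" for k
    using cardU[of k] that by (metis binomial_eq_0_iff card.empty not_less)
  have sub: "pmf (pmf_of_set {T. T \<subseteq> S \<and> card T = m}) T
      = (if T \<subseteq> S \<and> card T = m then 1 / real (M choose m) else 0)" if "S \<in> ?U M" for S
  proof -
    have S: "finite S" "card S = M"
      using that V finite_subset by auto
    have "card {T. T \<subseteq> S \<and> card T = m} = M choose m"
      using n_subsets[OF S(1)] S(2) by simp
    moreover from this have "{T. T \<subseteq> S \<and> card T = m} \<noteq> {}"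
      using m(1) by (metis binomial_eq_0_iff card.empty not_less)
    moreover have "finite {T. T \<subseteq> S \<and> card T = m}"
      using S(1) by simp
    ultimately show ?thesis
      by (simp add: pmf_of_set indicator_def)
  qed
  have "pmf (bind_pmf (pmf_of_set (?U M)) (\<lambda>S. pmf_of_set {T. T \<subseteq> S \<and> card T = m})) T
      = (\<Sum>S\<in>?U M. pmf (pmf_of_set {T. T \<subseteq> S \<and> card T = m}) T) / real (n choose M)"
    using ne[of M] fin[of M] cardU m(2)
    by (simp add: pmf_bind integral_pmf_of_set n_def)
  also have "(\<Sum>S\<in>?U M. pmf (pmf_of_set {T. T \<subseteq> S \<and> card T = m}) T)
      = (\<Sum>S\<in>?U M. if T \<subseteq> S \<and> card T = m then 1 / real (M choose m) else 0)"
    using sub by (intro sum.cong) auto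
  also have "\<dots> = real (card {S \<in> ?U M. T \<subseteq> S \<and> card T = m}) / real (M choose m)"
    using fin[of M] by (simp add: sum.If_cases Int_def)
  finally have lhs: "pmf (bind_pmf (pmf_of_set (?U M)) (\<lambda>S. pmf_of_set {T. T \<subseteq> S \<and> card T = m})) T
      = real (card {S \<in> ?U M. T \<subseteq> S \<and> card T = m}) / real (M choose m) / real (n choose M)" .
  have rhs: "pmf (pmf_of_set (?U m)) T = indicator (?U m) T / real (n choose m)"
    using ne[of m] fin[of m] cardU m n_def by (simp add: pmf_of_set)
  show "pmf (bind_pmf (pmf_of_set (?U M)) (\<lambda>S. pmf_of_set {T. T \<subseteq> S \<and> card T = m})) T
      = pmf (pmf_of_set (?U m)) T"
  proof (cases "T \<in> ?U m")
    case False
    then have none: "{S \<in> ?U M. T \<subseteq> S \<and> card T = m} = {}"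
      by auto
    from False show ?thesis
      unfolding lhs rhs none by simp
  next
    case True
    then have T: "T \<subseteq> V" "card T = m" "finite T"
      using V finite_subset by auto
    \<comment> \<open>An \<open>M\<close>-superset of \<open>T\<close> within \<open>V\<close>
      amounts to a choice of \<open>M - m\<close> further elements outside \<open>T\<close>.\<close>
    have "bij_betw (\<lambda>R. R \<union> T) {R. R \<subseteq> V - T \<and> card R = M - m}
        {S \<in> ?U M. T \<subseteq> S \<and> card T = m}"
    proof (rule bij_betw_byWitness[where f' = "\<lambda>S. S - T"])
      show "(\<lambda>R. R \<union> T) ` {R. R \<subseteq> V - T \<and> card R = M - m} \<subseteq> {S \<in> ?U M. T \<subseteq> S \<and> card T = m}"
      proof (rule image_subsetI)
        fix R assume "R \<in> {R. R \<subseteq> V - T \<and> card R = M - m}"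
        then have R: "R \<subseteq> V - T" "card R = M - m"
          by auto
        then have "card (R \<union> T) = card R + card T"
          using T V by (intro card_Un_disjoint) (auto intro: finite_subset)
        then show "R \<union> T \<in> {S \<in> ?U M. T \<subseteq> S \<and> card T = m}"
          using R T m by auto
      qed
      show "(\<lambda>S. S - T) ` {S \<in> ?U M. T \<subseteq> S \<and> card T = m} \<subseteq> {R. R \<subseteq> V - T \<and> card R = M - m}"
        using T by (auto simp: card_Diff_subset)
    qed auto
    then have "card {S \<in> ?U M. T \<subseteq> S \<and> card T = m} = card {R. R \<subseteq> V - T \<and> card R = M - m}"
      by (simp add: bij_betw_same_card)
    also have "\<dots> = (n - m) choose (M - m)"
      using n_subsets[of "V - T" "M - m"] V T n_def by (simp add: card_Diff_subset)
    finally have c: "card {S \<in> ?U M. T \<subseteq> S \<and> card T = m} = (n - m) choose (M - m)" .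
    \<comment> \<open>Both sides count the pairs of an \<open>m\<close>-set inside an
      \<open>M\<close>-set, by choosing the larger or the smaller one first.\<close>
    have "(n choose M) * (M choose m) = (n choose m) * ((n - m) choose (M - m))"
      using choose_mult m n_def by simp
    then have "real (n choose M) * real (M choose m)
        = real (n choose m) * real ((n - m) choose (M - m))"
      by (metis of_nat_mult)
    moreover have "0 < n choose M" "0 < M choose m" "0 < n choose m"
      using m n_def by auto
    ultimately show ?thesis
      using True unfolding lhs rhs c by (simp add: field_simps)
  qed
qed

text \<open>Union bound over the failure events, all under one joint distribution
  \<open>p\<close>.\<close>

lemma prob_Ball_ge:
  fixes p :: "'a pmf"
  assumes I: "finite I" and \<delta>: "\<And>i. i \<in> I \<Longrightarrow> measure_pmf.prob p {x. R i x} \<ge> 1 - \<delta>"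
  shows "measure_pmf.prob p {x. \<forall>i\<in>I. R i x} \<ge> 1 - real (card I) * \<delta>"
proof -
  have "measure_pmf.prob p (\<Union>i\<in>I. {x. \<not> R i x}) \<le> (\<Sum>i\<in>I. measure_pmf.prob p {x. \<not> R i x})"
    using I by (intro measure_pmf.finite_measure_subadditive_finite) auto
  also have "\<dots> \<le> (\<Sum>i\<in>I. \<delta>)"
  proof (rule sum_mono)
    fix i assume "i \<in> I"
    then show "measure_pmf.prob p {x. \<not> R i x} \<le> \<delta>"
      using \<delta>[of i] measure_pmf.prob_neg[where P = "R i" and M = p] by simp
  qed
  finally have "measure_pmf.prob p (\<Union>i\<in>I. {x. \<not> R i x}) \<le> real (card I) * \<delta>"
    by simp
  moreover have "(\<Union>i\<in>I. {x. \<not> R i x}) = {x. \<not> (\<forall>i\<in>I. R i x)}"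
    by auto
  ultimately show ?thesis
    using measure_pmf.prob_neg[where P = "\<lambda>x. \<forall>i\<in>I. R i x" and M = p] by simp
qed

section \<open>Decision trees\<close>

text \<open>
  \<open>query_all ps E f\<close> collects in \<open>E\<close> those of the pairs \<open>ps\<close> that turn out to be edges and then
  applies the randomized function \<open>f\<close>. As coins precede queries in a distribution over decision
  trees, the leaves draw their outputs independently of each other.
\<close>

primrec query_all ::
  "(nat \<times> nat) list \<Rightarrow> nat set set \<Rightarrow> (nat set set \<Rightarrow> real pmf) \<Rightarrow> decision_tree pmf" where
  "query_all [] E f = map_pmf Output (f E)"
| "query_all (p # ps) E f =
     bind_pmf (query_all ps E f) (\<lambda>t0.
       map_pmf (Query (fst p) (snd p) t0) (query_all ps (insert {fst p, snd p} E) f))"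

text \<open>The accumulator \<open>E'\<close> varies in the induction because the branch for a
  present edge enlarges it. On a given graph only one of the two drawn subtrees is visited, and the
  draw of the other one has no effect on the output.\<close>

lemma tree_output_query_all:
  "map_pmf (tree_output E) (query_all ps E' f) = f (E' \<union> {e \<in> E. \<exists>(u, v)\<in>set ps. e = {u, v}})"
proof (induction ps arbitrary: E')
  case Nil
  then show ?case
    by (simp add: pmf.map_comp comp_def)
next
  case (Cons p ps)
  show ?case
  proof (cases "{fst p, snd p} \<in> E")
    case True
    then have "map_pmf (tree_output E) (query_all (p # ps) E' f)
        = map_pmf (tree_output E) (query_all ps (insert {fst p, snd p} E') f)"
      by (simp add: map_bind_pmf pmf.map_comp comp_def bind_pmf_const)
    also have "\<dots> = f (insert {fst p, snd p} E' \<union> {e \<in> E. \<exists>(u, v)\<in>set ps. e = {u, v}})"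
      by (rule Cons.IH)
    also have "insert {fst p, snd p} E' \<union> {e \<in> E. \<exists>(u, v)\<in>set ps. e = {u, v}}
        = E' \<union> {e \<in> E. \<exists>(u, v)\<in>set (p # ps). e = {u, v}}"
      using True by (auto simp: case_prod_beta)
    finally show ?thesis .
  next
    case False
    then have "map_pmf (tree_output E) (query_all (p # ps) E' f)
        = map_pmf (tree_output E) (query_all ps E' f)"
      by (simp add: map_bind_pmf pmf.map_comp comp_def) (simp add: map_pmf_def)
    also have "\<dots> = f (E' \<union> {e \<in> E. \<exists>(u, v)\<in>set ps. e = {u, v}})"
      by (rule Cons.IH)
    also have "{e \<in> E. \<exists>(u, v)\<in>set ps. e = {u, v}} = {e \<in> E. \<exists>(u, v)\<in>set (p # ps). e = {u, v}}"
      using False by (auto simp: case_prod_beta)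
    finally show ?thesis .
  qed
qed

lemma tree_queries_query_all:
  "t \<in> set_pmf (query_all ps E' f) \<Longrightarrow> tree_queries E t = length ps"
  by (induction ps arbitrary: E' t) auto

text \<open>The tree queries all ordered pairs over \<open>S\<close>, diagonal included, which makes
  the count exactly \<open>(card S)\<^sup>2\<close> whatever the answers are. It is one tree
  distribution for all graphs, since the answers enter only through \<open>f\<close>.\<close>

lemma query_induced_subgraph:
  assumes "finite S"
  shows "\<exists>T. (\<forall>G\<in>graphs. map_pmf (tree_output (snd G)) T = f {e \<in> snd G. e \<subseteq> S}) \<and>
    (\<forall>E. \<forall>t\<in>set_pmf T. tree_queries E t = (card S)\<^sup>2)"
proof (intro exI conjI ballI allI)
  let ?ps = "List.product (sorted_list_of_set S) (sorted_list_of_set S)"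
  show "map_pmf (tree_output (snd G)) (query_all ?ps {} f) = f {e \<in> snd G. e \<subseteq> S}"
    if "G \<in> graphs" for G
  proof -
    \<comment> \<open>Sets not of this form, such as the empty set, could lie inside
      \<open>S\<close> without ever being queried; membership in \<open>graphs\<close> excludes them
      as edges.\<close>
    have "\<exists>u v. e = {u, v}" if "e \<in> snd G" for e
      using that \<open>G \<in> graphs\<close> by (cases G) (simp add: graphs_def, blast)
    then have "{e \<in> snd G. \<exists>(u, v)\<in>set ?ps. e = {u, v}} = {e \<in> snd G. e \<subseteq> S}"
      using assms by (fastforce simp: case_prod_beta)
    then show ?thesis
      by (simp add: tree_output_query_all)
  qed
  show "tree_queries E t = (card S)\<^sup>2" if "t \<in> set_pmf (query_all ?ps {} f)" for E t
    using tree_queries_query_all[OF that] by (simp add: power2_eq_square)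
qed

text \<open>\<open>T\<close> is fixed before \<open>G\<close>, while \<open>J\<close> is the joint
  distribution of all estimates on \<open>G\<close>. Only the marginals of \<open>J\<close> are
  described, which is all that a union bound uses; \<open>h\<close> is the final combination of the
  estimates.\<close>

lemma shared_sample_tree:
  fixes D :: "'a \<Rightarrow> nat set \<Rightarrow> nat set set \<Rightarrow> real pmf"
  assumes I: "finite I" and m: "\<forall>i\<in>I. m i \<le> M" and M: "M \<le> n"
  shows "\<exists>T. (\<forall>G\<in>graphs. fst G = n \<longrightarrow> (\<exists>J. map_pmf (tree_output (snd G)) T = map_pmf h J \<and>
      (\<forall>i\<in>I. map_pmf (\<lambda>r. r i) J = bind_pmf (pmf_of_set {S. S \<subseteq> {..<n} \<and> card S = m i})
        (\<lambda>S. D i S {e \<in> snd G. e \<subseteq> S})))) \<and>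
    (\<forall>E. \<forall>t\<in>set_pmf T. tree_queries E t = M\<^sup>2)"
proof -
  let ?U = "{S. S \<subseteq> {..<n} \<and> card S = M}"
  \<comment> \<open>Given the sample \<open>S\<close> and its induced edges, every estimator gets
    its own random \<open>m i\<close>-subset of \<open>S\<close> and its own coins. The 0 is the
    default value of \<open>Pi_pmf\<close> outside \<open>I\<close>.\<close>
  define K where "K S E = Pi_pmf I 0 (\<lambda>i. bind_pmf (pmf_of_set {T. T \<subseteq> S \<and> card T = m i})
    (\<lambda>T. D i T {e \<in> E. e \<subseteq> T}))" for S E
  have "\<forall>S. finite S \<longrightarrow> (\<exists>T. (\<forall>G\<in>graphs.
      map_pmf (tree_output (snd G)) T = map_pmf h (K S {e \<in> snd G. e \<subseteq> S})) \<and>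
      (\<forall>E. \<forall>t\<in>set_pmf T. tree_queries E t = (card S)\<^sup>2))"
    by (intro allI impI query_induced_subgraph[where f = "\<lambda>E. map_pmf h (K _ E)"])
  then obtain B where B: "\<And>S G. finite S \<Longrightarrow> G \<in> graphs \<Longrightarrow>
      map_pmf (tree_output (snd G)) (B S) = map_pmf h (K S {e \<in> snd G. e \<subseteq> S})"
    "\<And>S E t. finite S \<Longrightarrow> t \<in> set_pmf (B S) \<Longrightarrow> tree_queries E t = (card S)\<^sup>2"
    by metis
  have "finite ?U"
    by simp
  \<comment> \<open>\<open>M \<le> n\<close> guarantees that there is something to sample, so that
    the support of \<open>pmf_of_set ?U\<close> is \<open>?U\<close> itself.\<close>
  moreover have "?U \<noteq> {}"
    using M by (auto intro!: exI[of _ "{..<M}"])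
  ultimately have setU: "set_pmf (pmf_of_set ?U) = ?U"
    by simp
  then have finS: "finite S" if "S \<in> set_pmf (pmf_of_set ?U)" for S
    using that finite_subset by auto
  show ?thesis
  proof (intro exI[of _ "bind_pmf (pmf_of_set ?U) B"] conjI ballI allI impI)
    let ?T = "bind_pmf (pmf_of_set ?U) B"
    show "tree_queries E t = M\<^sup>2" if "t \<in> set_pmf ?T" for E t
    proof -
      obtain S where S: "S \<in> set_pmf (pmf_of_set ?U)" "t \<in> set_pmf (B S)"
        using \<open>t \<in> set_pmf ?T\<close> unfolding set_bind_pmf by blast
      moreover from S(1) have "card S = M"
        unfolding setU by simp
      ultimately show ?thesis
        using B(2) finS by metis
    qed
    fix G assume G: "G \<in> graphs" "fst G = n"
    let ?J = "bind_pmf (pmf_of_set ?U) (\<lambda>S. K S {e \<in> snd G. e \<subseteq> S})"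
    have "map_pmf (tree_output (snd G)) ?T = map_pmf h ?J"
      unfolding map_bind_pmf by (intro bind_pmf_cong refl B(1) finS G(1))
    moreover have "map_pmf (\<lambda>r. r i) ?J = bind_pmf (pmf_of_set {S. S \<subseteq> {..<n} \<and> card S = m i})
        (\<lambda>S. D i S {e \<in> snd G. e \<subseteq> S})" if i: "i \<in> I" for i
    proof -
      have "map_pmf (\<lambda>r. r i) ?J
          = bind_pmf (pmf_of_set ?U) (\<lambda>S. bind_pmf (pmf_of_set {T. T \<subseteq> S \<and> card T = m i})
              (\<lambda>T. D i T {e \<in> {e \<in> snd G. e \<subseteq> S}. e \<subseteq> T}))"
        unfolding map_bind_pmf K_def using i I by (simp add: Pi_pmf_component)
      \<comment> \<open>Edges inside \<open>T\<close> are the same in the subgraph induced by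
        \<open>S\<close> as in \<open>G\<close>, because \<open>T\<close> is a subset of
        \<open>S\<close>. To read this off the support of the inner distribution, \<open>S\<close>
        must have a subset of size \<open>m i\<close>, which \<open>m i \<le> M\<close>
        provides.\<close>
      also have "\<dots> = bind_pmf (pmf_of_set ?U) (\<lambda>S. bind_pmf (pmf_of_set {T. T \<subseteq> S \<and> card T = m i})
              (\<lambda>T. D i T {e \<in> snd G. e \<subseteq> T}))"
      proof (intro bind_pmf_cong refl)
        fix S T
        assume S: "S \<in> set_pmf (pmf_of_set ?U)"
          and T: "T \<in> set_pmf (pmf_of_set {T. T \<subseteq> S \<and> card T = m i})"
        have "m i \<le> card S"
          using S setU m i by auto
        then obtain T' where "T' \<subseteq> S" "card T' = m i"
          by (meson obtain_subset_with_card_n)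
        then have "{T. T \<subseteq> S \<and> card T = m i} \<noteq> {}"
          by auto
        moreover have "finite {T. T \<subseteq> S \<and> card T = m i}"
          using finS[OF S] by simp
        ultimately have "set_pmf (pmf_of_set {T. T \<subseteq> S \<and> card T = m i}) = {T. T \<subseteq> S \<and> card T = m i}"
          by (rule set_pmf_of_set)
        with T have "T \<subseteq> S"
          by (simp only: mem_Collect_eq)
        then have "{e \<in> {e \<in> snd G. e \<subseteq> S}. e \<subseteq> T} = {e \<in> snd G. e \<subseteq> T}"
          by auto
        then show "D i T {e \<in> {e \<in> snd G. e \<subseteq> S}. e \<subseteq> T} = D i T {e \<in> snd G. e \<subseteq> T}"
          by simp
      qed
      \<comment> \<open>By associativity the two-stage choice of \<open>T\<close> collapses to a
        uniform choice among the \<open>m i\<close>-subsets of all vertices.\<close>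
      also have "\<dots> = bind_pmf (pmf_of_set {S. S \<subseteq> {..<n} \<and> card S = m i})
        (\<lambda>S. D i S {e \<in> snd G. e \<subseteq> S})"
        using subset_of_random_subset[of "{..<n}" "m i" M] m i M
        by (simp flip: bind_assoc_pmf)
      finally show ?thesis .
    qed
    ultimately show "\<exists>J. map_pmf (tree_output (snd G)) ?T = map_pmf h J \<and>
      (\<forall>i\<in>I. map_pmf (\<lambda>r. r i) J = bind_pmf (pmf_of_set {S. S \<subseteq> {..<n} \<and> card S = m i})
        (\<lambda>S. D i S {e \<in> snd G. e \<subseteq> S}))"
      by blast
  qed
qed

section \<open>The distance-approximation algorithm\<close>

text \<open>The algorithm for one fixed order \<open>n\<close> and one fixed
  \<open>\<epsilon>\<close>. The constant 9 is the square of the 3 in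
  \<open>log 2 (3 * k) \<le> 3 * log_bound k\<close>.\<close>

lemma cover_tree:
  assumes P: "P \<subseteq> graphs" and F: "finite F" "\<forall>P'\<in>F. P' \<subseteq> graphs"
    and cover: "is_cover \<epsilon> F P"
    and est: "\<forall>P'\<in>F. \<exists>m D. sample_estimator m D q P' (\<epsilon> / 2)"
  shows "\<exists>T. (\<forall>G\<in>graphs. fst G = n \<longrightarrow> property_dist G P \<noteq> \<infinity> \<longrightarrow>
      measure_pmf.prob (map_pmf (tree_output (snd G)) T)
        {r. \<bar>ereal r - property_dist G P\<bar> \<le> ereal \<epsilon>} \<ge> 2 / 3) \<and>
    (\<forall>E. \<forall>t\<in>set_pmf T. real (tree_queries E t) \<le> 9 * (log_bound (card F))\<^sup>2 * q\<^sup>2)"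
proof (cases "\<exists>H\<in>P. fst H = n")
  case False
  then have "\<forall>G\<in>graphs. fst G = n \<longrightarrow> property_dist G P = \<infinity>"
    using property_dist_infinity_iff by blast
  then show ?thesis
    \<comment> \<open>The accuracy condition is vacuous for this order, so a leaf with an arbitrary
      value will do.\<close>
    by (intro exI[of _ "return_pmf (Output 0)"]) auto
next
  case True
  obtain m D where mD: "\<And>P'. P' \<in> F \<Longrightarrow> sample_estimator (m P') (D P') q P' (\<epsilon> / 2)"
    using est by metis
  define \<delta> where "\<delta> = 1 / (3 * real (card F))"
  \<comment> \<open>Some graph of order \<open>n\<close> lies in \<open>P\<close> and has to be
    covered. This makes \<open>\<delta>\<close> positive and the maximum below meaningful.\<close>
  have "F \<noteq> {}"
    using True cover unfolding is_cover_def by blast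
  then have k: "1 \<le> card F"
    using F(1) by (simp add: Suc_le_eq card_gt_0_iff)
  then have \<delta>: "0 < \<delta>" "\<delta> < 1" "real (card F) * \<delta> = 1 / 3"
    by (auto simp: \<delta>_def divide_simps)
  have m: "m P' n \<delta> \<le> n" "real (m P' n \<delta>) \<le> q * log 2 (1 / \<delta>)"
    and approx: "approximates (sample_output (m P') (D P') \<delta>) P' (\<epsilon> / 2) (1 - \<delta>)"
    if "P' \<in> F" for P'
    using mD[OF that] \<delta> unfolding sample_estimator_def by blast+
  define M where "M = Max ((\<lambda>P'. m P' n \<delta>) ` F)"
  \<comment> \<open>The maximum is the sample size of one particular estimator, so \<open>M\<close>
    inherits its bounds.\<close>
  have "M \<in> (\<lambda>P'. m P' n \<delta>) ` F"
    using F(1) \<open>F \<noteq> {}\<close> unfolding M_def by (intro Max_in) auto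
  then have M: "M \<le> n" "real M \<le> q * log 2 (1 / \<delta>)"
    using m by auto
  have le_M: "\<forall>P'\<in>F. m P' n \<delta> \<le> M"
    using F(1) unfolding M_def by (intro ballI Max_ge) auto
  \<comment> \<open>The members entering the minimum are selected by \<open>n\<close> and not by
    \<open>G\<close>, because \<open>T\<close> has to serve all graphs of order
    \<open>n\<close>.\<close>
  obtain T where T:
    "\<forall>G\<in>graphs. fst G = n \<longrightarrow> (\<exists>J. map_pmf (tree_output (snd G)) T
        = map_pmf (\<lambda>r. Min (r ` {P' \<in> F. \<exists>H\<in>P'. fst H = n})) J \<and>
      (\<forall>P'\<in>F. map_pmf (\<lambda>r. r P') J
        = bind_pmf (pmf_of_set {S. S \<subseteq> {..<n} \<and> card S = m P' n \<delta>})
            (\<lambda>S. D P' n \<delta> S {e \<in> snd G. e \<subseteq> S})))"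
    "\<forall>E. \<forall>t\<in>set_pmf T. tree_queries E t = M\<^sup>2"
    using shared_sample_tree[where I = F and m = "\<lambda>P'. m P' n \<delta>" and M = M and n = n
        and h = "\<lambda>r. Min (r ` {P' \<in> F. \<exists>H\<in>P'. fst H = n})" and D = "\<lambda>P'. D P' n \<delta>",
        OF F(1) le_M M(1)]
    by (elim exE conjE) (rule that)
  \<comment> \<open>\<open>log_bound\<close> is at least 1 and at least the logarithm of
    \<open>card F\<close>, so it absorbs both summands:
    \<open>2 + log 2 k \<le> 3 * log_bound k\<close>.\<close>
  have "log 2 (1 / \<delta>) = log 2 3 + log 2 (real (card F))"
    using k by (simp add: \<delta>_def log_mult)
  also have "log 2 3 \<le> (2::real)"
    by (simp add: log_le_iff)
  finally have "log 2 (1 / \<delta>) \<le> 3 * log_bound (card F)"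
    unfolding log_bound_def by linarith
  moreover have "0 < log 2 (1 / \<delta>)"
    using \<delta> by (simp add: divide_simps)
  ultimately have L: "(log 2 (1 / \<delta>))\<^sup>2 \<le> 9 * (log_bound (card F))\<^sup>2"
    using power_mono[of "log 2 (1 / \<delta>)" "3 * log_bound (card F)" 2]
    by (simp add: power_mult_distrib)
  have "(real M)\<^sup>2 \<le> (q * log 2 (1 / \<delta>))\<^sup>2"
    using M(2) by (intro power_mono) auto
  also have "\<dots> \<le> 9 * (log_bound (card F))\<^sup>2 * q\<^sup>2"
    using mult_right_mono[OF L, of "q\<^sup>2"] by (simp add: power_mult_distrib mult.commute)
  finally have queries: "(real M)\<^sup>2 \<le> 9 * (log_bound (card F))\<^sup>2 * q\<^sup>2" .
  have "measure_pmf.prob (map_pmf (tree_output (snd G)) T)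
      {r. \<bar>ereal r - property_dist G P\<bar> \<le> ereal \<epsilon>} \<ge> 2 / 3"
    if G: "G \<in> graphs" "fst G = n" "property_dist G P \<noteq> \<infinity>" for G
  proof -
    let ?I = "{P' \<in> F. property_dist G P' \<noteq> \<infinity>}"
    let ?ok = "\<lambda>P' x. \<bar>ereal x - property_dist G P'\<bar> \<le> ereal (\<epsilon> / 2)"
    \<comment> \<open>For a graph of order \<open>n\<close> the selection by order agrees with the
      selection by finite distance that \<open>cover_approximation\<close> uses.\<close>
    have "{P' \<in> F. \<exists>H\<in>P'. fst H = n} = ?I"
      using G(2) by (auto simp: property_dist_infinity_iff)
    then obtain J where J: "map_pmf (tree_output (snd G)) T = map_pmf (\<lambda>r. Min (r ` ?I)) J"
      "\<And>P'. P' \<in> F \<Longrightarrow> map_pmf (\<lambda>r. r P') J = sample_output (m P') (D P') \<delta> G"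
      using T(1)[rule_format, OF G(1,2)] unfolding sample_output_def G(2) by auto
    have "measure_pmf.prob J {r. ?ok P' (r P')} \<ge> 1 - \<delta>" if "P' \<in> ?I" for P'
    proof -
      have "measure_pmf.prob (map_pmf (\<lambda>r. r P') J) {x. ?ok P' x} \<ge> 1 - \<delta>"
        using approx[of P'] J(2)[of P'] that G(1) unfolding approximates_def by auto
      then show ?thesis
        by (simp add: vimage_def)
    qed
    then have "measure_pmf.prob J {r. \<forall>P'\<in>?I. ?ok P' (r P')} \<ge> 1 - real (card ?I) * \<delta>"
      using F(1) by (intro prob_Ball_ge) auto
    moreover have "real (card ?I) * \<delta> \<le> 1 / 3"
    proof -
      have "card ?I \<le> card F"
        using F(1) by (intro card_mono) auto
      then have "real (card ?I) * \<delta> \<le> real (card F) * \<delta>"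
        using \<delta>(1) by (intro mult_right_mono) auto
      then show ?thesis
        using \<delta>(3) by linarith
    qed
    ultimately have "2 / 3 \<le> measure_pmf.prob J {r. \<forall>P'\<in>?I. ?ok P' (r P')}"
      by linarith
    \<comment> \<open>Whenever all relevant estimates are accurate, their minimum is accurate for
      \<open>P\<close>, so one event contains the other.\<close>
    also have "\<dots> \<le> measure_pmf.prob J {r. \<bar>ereal (Min (r ` ?I)) - property_dist G P\<bar> \<le> ereal \<epsilon>}"
      using cover_approximation[OF F P cover G(1,3)]
      by (intro measure_pmf.finite_measure_mono) auto
    finally show ?thesis
      unfolding J(1) by (simp add: vimage_def)
  qed
  then show ?thesis
    using T(2) queries by (intro exI[of _ T]) auto
qed

text \<open>\<open>C\<close> is quantified before \<open>P\<close>, \<open>F\<close> and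
  \<open>q\<close>, so the constant hidden in the O-notation is absolute.\<close>

theorem theorem3p1:
  "\<exists>C::real. \<forall>(P::graph set) (F::real \<Rightarrow> graph set set) (q::real \<Rightarrow> real).
     P \<subseteq> graphs \<longrightarrow>
     (\<forall>\<epsilon>>0. finite (F \<epsilon>) \<and> (\<forall>P'\<in>F \<epsilon>. P' \<subseteq> graphs) \<and> is_cover \<epsilon> (F \<epsilon>) P \<and>
        (\<forall>P'\<in>F \<epsilon>. \<exists>m D. sample_estimator m D (q \<epsilon>) P' (\<epsilon> / 2))) \<longrightarrow>
     (\<exists>A. distance_approximation_algorithm A P \<and>
        query_complexity_le A (\<lambda>\<epsilon>. C * (log_bound (card (F \<epsilon>)))\<^sup>2 * (q \<epsilon>)\<^sup>2))"
proof (intro exI[of _ 9] allI impI)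
  fix P :: "graph set" and F :: "real \<Rightarrow> graph set set" and q :: "real \<Rightarrow> real"
  let ?good = "\<lambda>n \<epsilon> T. (\<forall>G\<in>graphs. fst G = n \<longrightarrow> property_dist G P \<noteq> \<infinity> \<longrightarrow>
      measure_pmf.prob (map_pmf (tree_output (snd G)) T)
        {r. \<bar>ereal r - property_dist G P\<bar> \<le> ereal \<epsilon>} \<ge> 2 / 3) \<and>
    (\<forall>E. \<forall>t\<in>set_pmf T. real (tree_queries E t) \<le> 9 * (log_bound (card (F \<epsilon>)))\<^sup>2 * (q \<epsilon>)\<^sup>2)"
  assume "P \<subseteq> graphs"
    and "\<forall>\<epsilon>>0. finite (F \<epsilon>) \<and> (\<forall>P'\<in>F \<epsilon>. P' \<subseteq> graphs) \<and> is_cover \<epsilon> (F \<epsilon>) P \<and>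
        (\<forall>P'\<in>F \<epsilon>. \<exists>m D. sample_estimator m D (q \<epsilon>) P' (\<epsilon> / 2))"
  then have ex: "\<exists>T. ?good n \<epsilon> T" if "0 < \<epsilon>" for n \<epsilon>
    using that by (intro cover_tree) auto
  \<comment> \<open>An algorithm is a tree distribution for each \<open>n\<close> and
    \<open>\<epsilon>\<close>, so these can be chosen separately; for
    \<open>\<epsilon> \<le> 0\<close> nothing is claimed about the choice.\<close>
  define A where "A n \<epsilon> = (SOME T. ?good n \<epsilon> T)" for n \<epsilon>
  have A: "?good n \<epsilon> (A n \<epsilon>)" if "0 < \<epsilon>" for n \<epsilon>
    unfolding A_def using ex[OF that] by (rule someI_ex)
  have "2 / 3 \<le> measure_pmf.prob (map_pmf (tree_output (snd G)) (A (fst G) \<epsilon>))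
      {r. \<bar>ereal r - property_dist G P\<bar> \<le> ereal \<epsilon>}"
    if "0 < \<epsilon>" "G \<in> graphs" "property_dist G P \<noteq> \<infinity>" for \<epsilon> G
    by (rule A[THEN conjunct1, rule_format, OF that(1,2) refl that(3)])
  then have "distance_approximation_algorithm A P"
    unfolding distance_approximation_algorithm_def approximates_def by simp
  moreover have "query_complexity_le A (\<lambda>\<epsilon>. 9 * (log_bound (card (F \<epsilon>)))\<^sup>2 * (q \<epsilon>)\<^sup>2)"
    unfolding query_complexity_le_def by (simp add: A[THEN conjunct2, rule_format])
  ultimately show "\<exists>A. distance_approximation_algorithm A P \<and>
      query_complexity_le A (\<lambda>\<epsilon>. 9 * (log_bound (card (F \<epsilon>)))\<^sup>2 * (q \<epsilon>)\<^sup>2)"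
    by blast
qed

end
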